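(* Let $d\ge 2$ and let $P$ be a probability measure on $(\mathbb{R}^d,\mathcal{B}^d)$ such that $P^a$ has a unique median for all $a\in\mathbb{S}_{d-1}$. Let $X_1,X_2,\ldots$ be independent random vectors with distribution $P$. For each $n\in\mathbb{N}$ let $(\theta_n,U_n)\in\mathbb{R}^d\times\mathbb{O}(d)$, with $\theta_n=\theta_n(X_1,\ldots,X_n)$ and $U_n=U_n(X_1,\ldots,X_n)$ Borel measurable functions on $(\mathbb{R}^d)^n$, be a solution of the quarter median problem for the (random) empirical distribution $P_n=n^{-1}\sum_{k=1}^n\delta_{X_k}$. (a) If the quarter median for $P$ is unique and given by $\theta\in\mathbb{R}^d$, then $\theta_n$ converges almost surely to $\theta$ as $n\to\infty$. (b) If the solution of the quarter median problem for $P$ is unique and given by $(\theta,H)\in\mathbb{R}^d\times\mathbb{H}(d)$, then $(\theta_n,[U_n])$ converges almost surely to $(\theta,H)$ in $\mathbb{R}^d\times\mathbb{H}(d)$ as $n\to\infty$.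
   Context: $\mathcal{B}^d$ is the Borel $\sigma$-field of $\mathbb{R}^d$. Vectors are columns, $x^{t}$ denotes the transpose, $\langle x,y\rangle=x^{t}y$, $\mathbb{S}_{d-1}$ is the Euclidean unit sphere in $\mathbb{R}^d$, $\mathbb{O}(d)$ is the group of orthogonal $d\times d$ matrices (with the topology induced by $\mathbb{R}^{d\times d}$) and $\mathbb{SO}(d)$ its subgroup of matrices with determinant 1. $\delta_x$ is unit mass at $x$. For $a\in\mathbb{S}_{d-1}$, $P^a$ is the push-forward of $P$ under $x\mapsto\langle a,x\rangle$. A median of a probability measure $Q$ on $\mathbb{R}$ is any $m$ with $Q((-\infty,m])\ge 1/2$ and $Q([m,\infty))\ge 1/2$. For $a\in\mathbb{R}^d$ and $b\in\mathbb{S}_{d-1}$ let $H_-(a;b)=\{x:\langle b,x-a\rangle\le 0\}$ and $H_+(a;b)=\{x:\langle b,x-a\rangle\ge 0\}$. For orthogonal $b,b'\in\mathbb{S}_{d-1}$ and signs $\sigma,\sigma'\in\{+,-\}$ let $V_{\sigma\sigma'}(a;b,b')=H_\sigma(a;b)\cap H_{\sigma'}(a;b')$. A pair $(\theta,U)\in\mathbb{R}^d\times\mathbb{O}(d)$, where $U$ has rows $b_1^{t},\ldots,b_d^{t}$, solves the quarter median problem for $P$ if $P(H_\pm(\theta;b_i))\ge 1/2$ for $1\le i\le d$ and both signs, and $P(V_{\sigma\sigma'}(\theta;b_i,b_j))\ge 1/4$ for $1\le i<j\le d$ and all four sign combinations. Then $\theta$ is called a quarter median of $P$. For $U,V\in\mathbb{O}(d)$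 write $U\sim V$ if the rows of $U$ and of $V$ determine the same set of linear hyperplanes $\{x:b_i^{t}x=0\}$; equivalently $V=AU$ for some $A\in G$, the finite group of signed permutation matrices. $[U]$ is the equivalence class of $U$, and $\mathbb{H}(d)=\mathbb{O}(d)/G$ is the set of these classes, equipped with the quotient topology, i.e. the finest topology for which $\mathbb{SO}(d)\to\mathbb{H}(d)$, $U\mapsto[U]$, is continuous. The quarter median of $P$ is unique if $\theta_1=\theta_2$ for any two solutions $(\theta_1,U_1),(\theta_2,U_2)$ of the quarter median problem for $P$. The solution of the quarter median problem for $P$ is unique, and given by $(\theta,H)\in\mathbb{R}^d\times\mathbb{H}(d)$, if every solution $(\theta_1,U_1)$ satisfies $\theta_1=\theta$ and $[U_1]=H$. *)

theory Defs
  imports "HOL-Analysis.Analysis" "HOL-Probability.Probability"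
begin

definition is_median :: "real measure \<Rightarrow> real \<Rightarrow> bool" where
  "is_median Q m \<longleftrightarrow> measure Q {..m} \<ge> 1/2 \<and> measure Q {m..} \<ge> 1/2"

definition projection_law :: "(real^'n) measure \<Rightarrow> real^'n \<Rightarrow> real measure" where
  "projection_law P a = distr P borel (\<lambda>x. a \<bullet> x)"

datatype sign = Minus | Plus

fun halfspace :: "sign \<Rightarrow> real^'n \<Rightarrow> real^'n \<Rightarrow> (real^'n) set" where
  "halfspace Minus a b = {x. b \<bullet> (x - a) \<le> 0}"
| "halfspace Plus a b = {x. b \<bullet> (x - a) \<ge> 0}"

definition quadrant :: "sign \<Rightarrow> sign \<Rightarrow> real^'n \<Rightarrow> real^'n \<Rightarrow> real^'n \<Rightarrow> (real^'n) set" where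
  "quadrant s s' a b b' = halfspace s a b \<inter> halfspace s' a b'"

text \<open>
  The index type carries no order, so the condition on pairs \<open>i < j\<close> is imposed for all
  \<open>i \<noteq> j\<close>. Since all four sign combinations are required, and
  \<open>quadrant s s' a b b' = quadrant s' s a b' b\<close>, this is the same condition.
\<close>

definition solves_quarter_median :: "(real^'n) measure \<Rightarrow> real^'n \<Rightarrow> real^'n^'n \<Rightarrow> bool" where
  "solves_quarter_median P \<theta> U \<longleftrightarrow>
     orthogonal_matrix U \<and>
     (\<forall>i s. measure P (halfspace s \<theta> (row i U)) \<ge> 1/2) \<and>
     (\<forall>i j. i \<noteq> j \<longrightarrow>
        (\<forall>s s'. measure P (quadrant s s' \<theta> (row i U) (row j U)) \<ge> 1/4))"

definition is_quarter_median :: "(real^'n) measure \<Rightarrow> real^'n \<Rightarrow> bool" where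
  "is_quarter_median P \<theta> \<longleftrightarrow> (\<exists>U. solves_quarter_median P \<theta> U)"

definition quarter_median_unique :: "(real^'n) measure \<Rightarrow> bool" where
  "quarter_median_unique P \<longleftrightarrow>
     (\<forall>\<theta>\<^sub>1 U\<^sub>1 \<theta>\<^sub>2 U\<^sub>2. solves_quarter_median P \<theta>\<^sub>1 U\<^sub>1 \<and> solves_quarter_median P \<theta>\<^sub>2 U\<^sub>2
        \<longrightarrow> \<theta>\<^sub>1 = \<theta>\<^sub>2)"

definition hyperplanes :: "real^'n^'n \<Rightarrow> (real^'n) set set" where
  "hyperplanes U = range (\<lambda>i. {x. row i U \<bullet> x = 0})"

definition hyperplane_equiv :: "((real^'n^'n) \<times> (real^'n^'n)) set" where
  "hyperplane_equiv =
     {(U, V). orthogonal_matrix U \<and> orthogonal_matrix V \<and> hyperplanes U = hyperplanes V}"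

definition hyperplane_class :: "real^'n^'n \<Rightarrow> (real^'n^'n) set" where
  "hyperplane_class U = hyperplane_equiv `` {U}"

definition hyperplane_space :: "(real^'n^'n) set set" where
  "hyperplane_space = {U. orthogonal_matrix U} // hyperplane_equiv"

lemma equiv_hyperplane_equiv: "equiv {U :: real^'n^'n. orthogonal_matrix U} hyperplane_equiv"
  by (rule equivI) (auto simp: hyperplane_equiv_def refl_on_def sym_def trans_def)

text \<open>
  The final topology for the map \<open>hyperplane_class\<close> restricted to the rotation matrices, i.e.
  the finest topology on \<open>hyperplane_space\<close> that makes this map continuous.
\<close>

definition hyperplane_topology :: "(real^'n^'n) set topology" where
  "hyperplane_topology = topology (\<lambda>W. W \<subseteq> hyperplane_space \<and>
     openin (top_of_set {U. rotation_matrix U}) {U. rotation_matrix U \<and> hyperplane_class U \<in> W})"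

lemma hyperplane_class_in_space:
  "orthogonal_matrix U \<Longrightarrow> hyperplane_class U \<in> hyperplane_space"
  by (auto simp: hyperplane_class_def hyperplane_space_def intro: quotientI)

lemma openin_hyperplane_topology:
  fixes W :: "(real^'n^'n) set set"
  shows "openin hyperplane_topology W \<longleftrightarrow> W \<subseteq> hyperplane_space \<and>
     openin (top_of_set {U. rotation_matrix U}) {U. rotation_matrix U \<and> hyperplane_class U \<in> W}"
proof -
  let ?p = "\<lambda>W :: (real^'n^'n) set set. {U. rotation_matrix U \<and> hyperplane_class U \<in> W}"
  let ?L = "\<lambda>W. W \<subseteq> hyperplane_space \<and> openin (top_of_set {U. rotation_matrix U}) (?p W)"
  have "istopology ?L"
    unfolding istopology_def
  proof (intro conjI allI impI)
    fix S T assume S: "?L S" and T: "?L T"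
    show "S \<inter> T \<subseteq> hyperplane_space" using S by blast
    have "?p (S \<inter> T) = ?p S \<inter> ?p T" by blast
    then show "openin (top_of_set {U. rotation_matrix U}) (?p (S \<inter> T))"
      using S T by (simp only: openin_Int)
  next
    fix K assume K: "\<forall>W\<in>K. ?L W"
    show "\<Union>K \<subseteq> hyperplane_space" using K by blast
    have "?p (\<Union>K) = (\<Union>W\<in>K. ?p W)" by blast
    then show "openin (top_of_set {U. rotation_matrix U}) (?p (\<Union>K))"
      using K by (auto simp only: intro!: openin_Union)
  qed
  then show ?thesis
    by (simp add: hyperplane_topology_def topology_inverse')
qed

lemma topspace_hyperplane_topology:
  "topspace (hyperplane_topology :: (real^'n^'n) set topology) = hyperplane_space"
proof -
  have "{U :: real^'n^'n. rotation_matrix U \<and> hyperplane_class U \<in> hyperplane_space}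
          = {U. rotation_matrix U}"
    by (auto simp: rotation_matrix_def hyperplane_class_in_space)
  then have "openin hyperplane_topology (hyperplane_space :: (real^'n^'n) set set)"
    by (simp add: openin_hyperplane_topology)
  then have "hyperplane_space \<subseteq> topspace (hyperplane_topology :: (real^'n^'n) set topology)"
    by (rule openin_subset)
  moreover have "topspace (hyperplane_topology :: (real^'n^'n) set topology) \<subseteq> hyperplane_space"
    using openin_topspace[of "hyperplane_topology :: (real^'n^'n) set topology"]
    unfolding openin_hyperplane_topology by blast
  ultimately show ?thesis by blast
qed

definition empirical_measure :: "nat \<Rightarrow> (nat \<Rightarrow> 'a::topological_space) \<Rightarrow> 'a measure" where
  "empirical_measure n x = distr (uniform_count_measure {1..n}) borel x"

lemma measure_empirical_measure:
  assumes "n \<ge> 1" "A \<in> sets borel"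
  shows "measure (empirical_measure n x) A = (\<Sum>k=1..n. measure (return borel (x k)) A) / n"
proof -
  have "measure (empirical_measure n x) A = card (x -` A \<inter> {1..n}) / n"
    unfolding empirical_measure_def using assms
    by (subst measure_distr)
       (auto simp: measure_uniform_count_measure space_uniform_count_measure sets_uniform_count_measure
             measurable_def)
  also have "card (x -` A \<inter> {1..n}) = (\<Sum>k=1..n. indicator (x -` A) k)"
    using sum_indicator_eq_card[of "{1..n}" "x -` A"] by (simp only: finite_atLeastAtMost Int_commute)
  also have "real \<dots> = (\<Sum>k=1..n. indicator A (x k))"
    unfolding of_nat_sum by (rule sum.cong) (auto simp: indicator_def)
  finally show ?thesis
    using assms by (simp add: measure_return)
qed

end

theory Submission
  imports Defs
begin

text \<open>
  Everything follows from one fact: any limit point of a sequence of solutions for the empirical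
  measures is a solution for \<open>P\<close>.

  Almost surely, \<open>liminf P\<^sub>n(O) \<ge> P(O)\<close> for all open sets \<open>O\<close> at once
  (\<open>AE_empirical_portmanteau\<close>): the relative frequencies converge for each of the countably many
  finite unions of basic open sets, and every open set is an increasing limit of such unions. From
  here on the argument is deterministic and concerns a single realisation.

  The half-spaces and quadrants are the sections of closed relations between the parameter
  \<open>(\<theta>, U)\<close> and the points of the space. If \<open>(\<theta>\<^sub>n, U\<^sub>n)\<close> tends to \<open>(\<theta>, U)\<close>, then eventually the section
  at \<open>(\<theta>\<^sub>n, U\<^sub>n)\<close> lies inside the union of the sections over a fixed compact neighbourhood of
  \<open>(\<theta>, U)\<close>. This union is closed, so the portmanteau inequality bounds its empirical measure, and
  when the neighbourhood shrinks it decreases to the section at \<open>(\<theta>, U)\<close>. So the inequalities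
  \<open>\<ge> 1/2\<close> and \<open>\<ge> 1/4\<close> pass to the limit (\<open>solves_quarter_median_limit\<close>).

  The solutions \<open>(\<theta>\<^sub>n, U\<^sub>n)\<close> eventually stay in a compact set: each row of \<open>U\<^sub>n\<close> has norm one, and if a
  ball around the origin has more than half of the mass then both half-spaces of each row meet it,
  which bounds the coordinates of \<open>\<theta>\<^sub>n\<close> in the basis given by \<open>U\<^sub>n\<close>. By compactness the solutions
  eventually enter every open neighbourhood of the set of solutions for \<open>P\<close>. Both parts of
  the theorem are instances of this. The second part takes the preimage of an open subset of
  \<open>hyperplane_space\<close> as the neighbourhood; its openness in the orthogonal group, rather than only among
  the rotations, is due to a continuous map that turns each orthogonal matrix into an
  equivalent rotation.
\<close>

section \<open>Empirical measures and open sets\<close>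

text \<open>
  The portmanteau description of weak convergence in terms of open sets. This form
  survives the passage from countably many sets to all sets in \<open>AE_empirical_portmanteau\<close>, because
  only a lower bound has to be carried over.
\<close>

definition portmanteau_limit :: "(nat \<Rightarrow> 'a::topological_space measure) \<Rightarrow> 'a measure \<Rightarrow> bool" where
  "portmanteau_limit Q P \<longleftrightarrow>
     (\<forall>A c. open A \<longrightarrow> c < measure P A \<longrightarrow> (\<forall>\<^sub>F n in sequentially. c < measure (Q n) A))"

lemma portmanteau_limitD:
  "portmanteau_limit Q P \<Longrightarrow> open A \<Longrightarrow> c < measure P A \<Longrightarrow>
    \<forall>\<^sub>F n in sequentially. c < measure (Q n) A"
  by (simp add: portmanteau_limit_def)

lemma sets_empirical_measure [simp]: "sets (empirical_measure n x) = sets borel"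
  by (simp add: empirical_measure_def)

lemma prob_space_empirical_measure:
  assumes "n \<ge> 1"
  shows "prob_space (empirical_measure n x)"
proof -
  interpret prob_space "uniform_count_measure {1..n}"
    using assms by (intro prob_space_uniform_count_measure) auto
  show ?thesis
    unfolding empirical_measure_def
    by (rule prob_space_distr) (simp add: measurable_def space_uniform_count_measure sets_uniform_count_measure)
qed

text \<open>
  The strong law of large numbers for relative frequencies. Indicators are bounded, so Hoeffding's
  inequality gives deviation probabilities that are summable in \<open>n\<close>, and the Borel--Cantelli lemma
  applies.
\<close>

lemma (in prob_space) AE_empirical_measure_tendsto:
  fixes X :: "nat \<Rightarrow> 'a \<Rightarrow> 'b::topological_space"
  assumes indep: "indep_vars (\<lambda>_. borel) X {1..}"
    and distr: "\<And>k. k \<ge> 1 \<Longrightarrow> distr M borel (X k) = P"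
    and A: "A \<in> sets borel"
  shows "AE \<omega> in M. (\<lambda>n. measure (empirical_measure n (\<lambda>k. X k \<omega>)) A) \<longlonglongrightarrow> measure P A"
proof -
  have X_meas: "X k \<in> borel_measurable M" if "k \<ge> 1" for k
    using indep that unfolding indep_vars_def by auto
  define Y :: "nat \<Rightarrow> 'a \<Rightarrow> real" where "Y k \<omega> = indicator A (X k \<omega>)" for k \<omega>
  have ind_meas: "(indicator A :: 'b \<Rightarrow> real) \<in> borel_measurable borel"
    using A by simp
  have indep_Y: "indep_vars (\<lambda>_. borel) Y {1..}"
    unfolding Y_def by (rule indep_vars_compose2[OF indep]) (use A in auto)
  have Y_meas: "Y k \<in> borel_measurable M" if "k \<ge> 1" for k
    using indep_Y that unfolding indep_vars_def by auto
  have distr_Y: "distr M borel (Y k) = distr P borel (indicator A)" if "k \<ge> 1" for k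
    using distr_distr[OF ind_meas X_meas[OF that]] distr[OF that]
    by (simp add: Y_def[abs_def] o_def)
  have exp_Y: "expectation (Y 1) = measure P A"
  proof -
    have "measure P A = measure M (X 1 -` A \<inter> space M)"
      using distr[of 1] A X_meas[of 1] by (metis measure_distr order_refl)
    also have "\<dots> = expectation (indicator (X 1 -` A \<inter> space M))"
      using measurable_sets[OF X_meas[of 1] A] by simp
    also have "\<dots> = expectation (Y 1)"
      by (rule Bochner_Integration.integral_cong) (auto simp: Y_def indicator_def)
    finally show ?thesis ..
  qed
  have emp: "measure (empirical_measure n (\<lambda>k. X k \<omega>)) A = (\<Sum>k\<in>{1..n}. Y k \<omega>) / n"
    if "n \<ge> 1" for n \<omega>
    using measure_empirical_measure[OF that A] A by (simp add: measure_return Y_def)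
  define B where "B e n = {\<omega> \<in> space M. \<bar>(\<Sum>k\<in>{1..n}. Y k \<omega>) / n - measure P A\<bar> \<ge> e}"
    for e :: real and n :: nat
  have B_meas: "B e n \<in> sets M" for e n
  proof -
    have [measurable]: "(\<lambda>\<omega>. \<Sum>k\<in>{1..n}. Y k \<omega>) \<in> borel_measurable M"
      by (rule borel_measurable_sum) (use Y_meas in auto)
    show ?thesis unfolding B_def by measurable
  qed
  have B_bound: "measure M (B e n) \<le> 2 * exp (-2 * e\<^sup>2) ^ n" if "e > 0" for e n
  proof (cases "n = 0")
    case True
    then show ?thesis using order_trans[OF prob_le_1[of "B e n"], of 2] by simp
  next
    case False
    interpret H: Hoeffding_ineq_iid M "{1..n}" Y "Y 1" 0 1 "measure P A"
    proof unfold_locales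
      show "indep_vars (\<lambda>_. borel) Y {1..n}"
        by (rule indep_vars_subset[OF indep_Y]) auto
      show "distr M borel (Y i) = distr M borel (Y 1)" if "i \<in> {1..n}" for i
        using that distr_Y by simp
      show "AE x in M. Y 1 x \<in> {0..1}"
        by (auto simp: Y_def indicator_def)
      show "measure P A \<equiv> expectation (Y 1)"
        using exp_Y by simp
    qed (use Y_meas in auto)
    have "measure M (B e n) \<le> 2 * exp (-2 * n * e\<^sup>2)"
      using H.Hoeffding_ineq_abs_ge'[of e] that False by (simp add: B_def)
    also have "exp (-2 * n * e\<^sup>2) = exp (-2 * e\<^sup>2) ^ n"
      by (simp add: exp_of_nat_mult[symmetric] algebra_simps)
    finally show ?thesis .
  qed
  have "AE \<omega> in M. \<forall>\<^sub>F n in sequentially. \<omega> \<in> space M - B e n" if "e > 0" for e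
  proof (rule borel_cantelli_AE1)
    have "summable (\<lambda>n. 2 * exp (-2 * e\<^sup>2) ^ n)"
      using that by (intro summable_mult summable_geometric) simp
    then show "summable (\<lambda>n. measure M (B e n))"
      by (rule summable_comparison_test'[where N = 0]) (use B_bound[OF that] in simp)
  qed (auto simp: B_meas emeasure_eq_measure)
  then have "AE \<omega> in M. \<forall>j. \<forall>\<^sub>F n in sequentially. \<omega> \<in> space M - B (1 / Suc j) n"
    by (simp add: AE_all_countable)
  then show ?thesis
  proof (rule AE_mp, intro AE_I2 impI)
    fix \<omega> assume *: "\<forall>j. \<forall>\<^sub>F n in sequentially. \<omega> \<in> space M - B (1 / Suc j) n"
    show "(\<lambda>n. measure (empirical_measure n (\<lambda>k. X k \<omega>)) A) \<longlonglongrightarrow> measure P A"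
    proof (rule tendstoI)
      fix e :: real assume "e > 0"
      then obtain j where j: "1 / Suc j < e"
        using nat_approx_posE by blast
      show "\<forall>\<^sub>F n in sequentially.
          dist (measure (empirical_measure n (\<lambda>k. X k \<omega>)) A) (measure P A) < e"
        using *[rule_format, of j] eventually_ge_at_top[of 1]
      proof eventually_elim
        case (elim n)
        then show ?case
          using j unfolding emp[OF elim(2)] by (auto simp: B_def dist_real_def)
      qed
    qed
  qed
qed

text \<open>
  Only countably many sets can be handled by the strong law, and the finite unions of basic open
  sets are enough: continuity from below lets one of them carry almost all the mass of a given
  open set.
\<close>

lemma (in prob_space) AE_empirical_portmanteau:
  fixes X :: "nat \<Rightarrow> 'a \<Rightarrow> 'b::second_countable_topology"
  assumes indep: "indep_vars (\<lambda>_. borel) X {1..}"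
    and distr: "\<And>k. k \<ge> 1 \<Longrightarrow> distr M borel (X k) = P"
  shows "AE \<omega> in M. portmanteau_limit (\<lambda>n. empirical_measure n (\<lambda>k. X k \<omega>)) P"
proof -
  have [simp]: "sets P = sets borel"
    using distr[of 1] by auto
  interpret P: prob_space P
    using distr[of 1] indep unfolding indep_vars_def by (auto intro!: prob_space_distr)
  obtain B :: "'b set set" where B: "countable B" "topological_basis B"
    using ex_countable_basis by blast
  define F where "F = Union ` {C. finite C \<and> C \<subseteq> B}"
  have "countable F"
    unfolding F_def by (intro countable_image countable_Collect_finite_subset B)
  have F_open: "open A" if "A \<in> F" for A
    using that B(2) unfolding F_def by (auto dest: topological_basis_open)
  have "AE \<omega> in M. \<forall>A\<in>F.
      (\<lambda>n. measure (empirical_measure n (\<lambda>k. X k \<omega>)) A) \<longlonglongrightarrow> measure P A"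
    using \<open>countable F\<close> F_open
    by (subst AE_ball_countable) (auto intro!: AE_empirical_measure_tendsto[OF indep distr])
  then show ?thesis
  proof (rule AE_mp, intro AE_I2 impI)
    fix \<omega> assume lim: "\<forall>A\<in>F.
      (\<lambda>n. measure (empirical_measure n (\<lambda>k. X k \<omega>)) A) \<longlonglongrightarrow> measure P A"
    let ?Q = "\<lambda>n. empirical_measure n (\<lambda>k. X k \<omega>)"
    have Q_fin: "finite_measure (?Q n)" if "n \<ge> 1" for n
      using prob_space_empirical_measure[OF that] by (rule prob_space.finite_measure)
    show "portmanteau_limit ?Q P"
      unfolding portmanteau_limit_def
    proof (intro allI impI)
      fix A :: "'b set" and c :: real
      assume "open A" and c: "c < measure P A"
      then obtain C where C: "C \<subseteq> B" "\<Union>C = A"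
        using B(2) unfolding topological_basis_def by metis
      \<comment> \<open>Inserting the empty set makes the family nonempty, so that it can be enumerated.\<close>
      define g where "g = from_nat_into (insert {} C)"
      have range_g: "range g = insert {} C"
        unfolding g_def using B(1) C(1) by (intro range_from_nat_into) (auto intro: countable_subset)
      define D where "D k = (\<Union>i\<le>k. g i)" for k
      have D_F: "D k \<in> F" for k
      proof -
        have "D k = \<Union>((g ` {..k}) - {{}})" unfolding D_def by auto
        moreover have "(g ` {..k}) - {{}} \<subseteq> B" using range_g C(1) by auto
        ultimately show ?thesis unfolding F_def by blast
      qed
      have D_A: "(\<Union>k. D k) = A"
      proof -
        have "(\<Union>k. D k) = \<Union>(range g)" unfolding D_def by auto
        then show ?thesis using range_g C(2) by simp
      qed
      have "(\<lambda>k. measure P (D k)) \<longlonglongrightarrow> measure P (\<Union>k. D k)"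
      proof (rule P.finite_Lim_measure_incseq)
        show "range D \<subseteq> sets P" using D_F F_open by auto
        show "incseq D" unfolding D_def incseq_def by force
      qed
      then have "\<forall>\<^sub>F k in sequentially. c < measure P (D k)"
        using c D_A by (auto intro: order_tendstoD)
      then obtain k where k: "c < measure P (D k)"
        using eventually_happens by force
      have "\<forall>\<^sub>F n in sequentially. c < measure (?Q n) (D k)"
        using lim D_F k by (auto intro: order_tendstoD)
      then show "\<forall>\<^sub>F n in sequentially. c < measure (?Q n) A"
        using eventually_ge_at_top[of 1]
      proof eventually_elim
        case (elim n)
        have "measure (?Q n) (D k) \<le> measure (?Q n) A"
          using D_A \<open>open A\<close>
          by (intro finite_measure.finite_measure_mono[OF Q_fin[OF elim(2)]]) auto
        with elim show ?case by simp
      qed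
    qed
  qed
qed

section \<open>Passing to the limit in closed relations\<close>

lemma portmanteau_limit_subseq:
  assumes "portmanteau_limit Q P" "strict_mono r"
  shows "portmanteau_limit (\<lambda>n. Q (r n)) P"
  unfolding portmanteau_limit_def
  by (intro allI impI eventually_subseq[OF assms(2)] portmanteau_limitD[OF assms(1)])

lemma portmanteau_limit_closed:
  assumes lim: "portmanteau_limit Q P"
    and P: "prob_space P" "sets P = sets borel"
    and Q: "\<forall>\<^sub>F n in sequentially. prob_space (Q n)" "\<And>n. sets (Q n) = sets borel"
    and "closed A" "measure P A < c"
  shows "\<forall>\<^sub>F n in sequentially. measure (Q n) A < c"
proof -
  have compl: "measure R (- A) = 1 - measure R A" if "prob_space R" "sets R = sets borel"
    for R :: "'a measure"
  proof -
    have "A \<in> sets R" "space R = UNIV"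
      using \<open>closed A\<close> that(2) sets_eq_imp_space_eq[OF that(2)] by auto
    then show ?thesis
      using prob_space.prob_compl[OF that(1)] by (simp add: Compl_eq_Diff_UNIV)
  qed
  have "1 - c < measure P (- A)"
    using compl[OF P] \<open>measure P A < c\<close> by simp
  then have "\<forall>\<^sub>F n in sequentially. 1 - c < measure (Q n) (- A)"
    using \<open>closed A\<close> by (intro portmanteau_limitD[OF lim]) auto
  with Q(1) show ?thesis
    by eventually_elim (use compl Q(2) in force)
qed

text \<open>
  Sections of a closed relation are upper semicontinuous: the section at a nearby parameter is
  contained in the union of the sections over a small ball. These unions are closed because the
  ball is compact, and they decrease to the section at its centre because the relation is closed.
\<close>

lemma portmanteau_limit_section:
  fixes R :: "('p::euclidean_space \<times> 'x::euclidean_space) set"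
  assumes lim: "portmanteau_limit Q P"
    and P: "prob_space P" "sets P = sets borel"
    and Q: "\<forall>\<^sub>F n in sequentially. prob_space (Q n)" "\<And>n. sets (Q n) = sets borel"
    and R: "closed R"
    and p: "p \<longlonglongrightarrow> p\<^sub>0"
    and c: "\<forall>\<^sub>F n in sequentially. c \<le> measure (Q n) (R `` {p n})"
  shows "c \<le> measure P (R `` {p\<^sub>0})"
proof (rule ccontr)
  assume "\<not> c \<le> measure P (R `` {p\<^sub>0})"
  then have less: "measure P (R `` {p\<^sub>0}) < c" by simp
  interpret P: prob_space P by fact
  define N where "N k = {x. \<exists>q. q \<in> cball p\<^sub>0 (1 / Suc k) \<and> (q, x) \<in> R}" for k :: nat
  have N_closed: "closed (N k)" for k
    unfolding N_def by (rule closed_compact_projection[OF compact_cball R])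
  have N_Inter: "(\<Inter>k. N k) = R `` {p\<^sub>0}"
  proof (intro equalityI subsetI)
    fix x assume "x \<in> (\<Inter>k. N k)"
    then have "\<forall>k. \<exists>q. q \<in> cball p\<^sub>0 (1 / Suc k) \<and> (q, x) \<in> R"
      by (simp add: N_def)
    then obtain q where q: "\<And>k. q k \<in> cball p\<^sub>0 (1 / Suc k)" "\<And>k. (q k, x) \<in> R"
      by metis
    have "(\<lambda>k. dist (q k) p\<^sub>0) \<longlonglongrightarrow> 0"
      using q(1) by (intro Lim_null_comparison[OF _ lim_1_over_n[THEN LIMSEQ_Suc]] always_eventually)
        (simp add: dist_commute)
    then have "q \<longlonglongrightarrow> p\<^sub>0" by (rule tendsto_dist_iff[THEN iffD2])
    then have "(\<lambda>k. (q k, x)) \<longlonglongrightarrow> (p\<^sub>0, x)" by (intro tendsto_intros)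
    with R q(2) have "(p\<^sub>0, x) \<in> R" by (rule closed_sequentially)
    then show "x \<in> R `` {p\<^sub>0}" by simp
  qed (force simp: N_def)
  have "(\<lambda>k. measure P (N k)) \<longlonglongrightarrow> measure P (\<Inter>k. N k)"
  proof (rule P.finite_Lim_measure_decseq)
    show "range N \<subseteq> sets P" using N_closed P(2) by auto
    show "decseq N"
      unfolding decseq_def
    proof (intro allI impI subsetI)
      fix k l :: nat and x assume "k \<le> l" "x \<in> N l"
      moreover have "cball p\<^sub>0 (1 / Suc l) \<subseteq> cball p\<^sub>0 (1 / Suc k)"
        using \<open>k \<le> l\<close> by (intro subset_cball) (simp add: frac_le)
      ultimately show "x \<in> N k" unfolding N_def by blast
    qed
  qed
  then have "\<forall>\<^sub>F k in sequentially. measure P (N k) < c"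
    using less N_Inter by (auto intro: order_tendstoD)
  then obtain k where "measure P (N k) < c"
    using eventually_happens by force
  then have "\<forall>\<^sub>F n in sequentially. measure (Q n) (N k) < c"
    by (intro portmanteau_limit_closed[OF lim P Q N_closed])
  moreover have "\<forall>\<^sub>F n in sequentially. dist (p n) p\<^sub>0 < 1 / Suc k"
    using p by (rule tendstoD) simp
  ultimately have "\<forall>\<^sub>F n in sequentially. False"
    using c Q(1)
  proof eventually_elim
    case (elim n)
    interpret Qn: prob_space "Q n" by (rule elim)
    have "R `` {p n} \<subseteq> N k"
      using elim(2) unfolding N_def by (auto intro!: exI[of _ "p n"] simp: dist_commute)
    then have "measure (Q n) (R `` {p n}) \<le> measure (Q n) (N k)"
      using N_closed Q(2) by (intro Qn.finite_measure_mono) auto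
    with elim show ?case by simp
  qed
  then show False by simp
qed

lemma eventually_in_open_of_limit_points:
  fixes p :: "nat \<Rightarrow> 'a::metric_space"
  assumes K: "compact K" "\<forall>\<^sub>F n in sequentially. p n \<in> K"
    and W: "open W"
    and limit_points: "\<And>r l. strict_mono r \<Longrightarrow> l \<in> K \<Longrightarrow> (\<lambda>n. p (r n)) \<longlonglongrightarrow> l \<Longrightarrow> l \<in> W"
  shows "\<forall>\<^sub>F n in sequentially. p n \<in> W"
proof (rule ccontr)
  assume not_W: "\<not> (\<forall>\<^sub>F n in sequentially. p n \<in> W)"
  have "\<not> (\<forall>\<^sub>F n in sequentially. \<not> p n \<in> K - W)"
  proof
    assume "\<forall>\<^sub>F n in sequentially. \<not> p n \<in> K - W"
    with K(2) have "\<forall>\<^sub>F n in sequentially. p n \<in> W" by eventually_elim auto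
    with not_W show False ..
  qed
  then obtain r where r: "strict_mono (r :: nat \<Rightarrow> nat)" "\<forall>n. p (r n) \<in> K - W"
    using not_eventually_sequentiallyD by blast
  have "seq_compact (K - W)"
    using compact_diff[OF K(1) W] by (simp add: compact_eq_seq_compact_metric)
  then obtain l s where l: "l \<in> K - W" "strict_mono s" "((\<lambda>n. p (r n)) \<circ> s) \<longlonglongrightarrow> l"
    using r(2) by (rule seq_compactE[where f = "\<lambda>n. p (r n)"])
  then have "l \<in> W"
    using limit_points[of "\<lambda>n. r (s n)" l] strict_mono_compose[OF r(1) l(2)] by (simp add: o_def)
  with l(1) show False by simp
qed

section \<open>Solutions of the quarter median problem\<close>

lemma closed_halfspace_relation:
  "closed {(p :: (real^'n) \<times> (real^'n^'n), x). x \<in> halfspace s (fst p) (row i (snd p))}"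
  by (cases s)
     (auto simp: case_prod_unfold row_def intro!: closed_Collect_le continuous_intros)

lemma closed_orthogonal_matrices: "closed {U :: real^'n^'n. orthogonal_matrix U}"
proof -
  have "{U :: real^'n^'n. orthogonal_matrix U} =
      {U. (\<forall>i. norm (U $ i) = 1) \<and> (\<forall>i j. i \<noteq> j \<longrightarrow> U $ i \<bullet> U $ j = 0)}"
    unfolding orthogonal_matrix_orthonormal_rows orthogonal_def row_def by simp
  also have "closed \<dots>"
    by (intro closed_Collect_conj closed_Collect_all closed_Collect_imp closed_Collect_eq
          open_Collect_const continuous_intros)
  finally show ?thesis .
qed

theorem solves_quarter_median_limit:
  fixes P :: "(real^'n) measure"
  assumes lim: "portmanteau_limit Q P"
    and P: "prob_space P" "sets P = sets borel"
    and Q: "\<forall>\<^sub>F n in sequentially. prob_space (Q n)" "\<And>n. sets (Q n) = sets borel"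
    and sol: "\<forall>\<^sub>F n in sequentially. solves_quarter_median (Q n) (\<theta> n) (U n)"
    and conv: "(\<lambda>n. (\<theta> n, U n)) \<longlonglongrightarrow> (\<theta>\<^sub>0, U\<^sub>0)"
  shows "solves_quarter_median P \<theta>\<^sub>0 U\<^sub>0"
proof -
  \<comment> \<open>Quadrants are intersections of two half-spaces, so their relations are closed as well.\<close>
  define H :: "sign \<Rightarrow> 'n \<Rightarrow> (((real^'n) \<times> (real^'n^'n)) \<times> (real^'n)) set"
    where "H s i = {(p, x). x \<in> halfspace s (fst p) (row i (snd p))}" for s i
  have H_closed: "closed (H s i)" for s i
    unfolding H_def by (rule closed_halfspace_relation)
  have H_section: "H s i `` {(\<theta>, U)} = halfspace s \<theta> (row i U)" for s i \<theta> U
    by (auto simp: H_def)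
  have quadrant_section: "(H s i \<inter> H s' j) `` {(\<theta>, U)} = quadrant s s' \<theta> (row i U) (row j U)"
    for s s' i j \<theta> U
    by (auto simp: H_def quadrant_def)
  have "U \<longlonglongrightarrow> U\<^sub>0"
    using tendsto_snd[OF conv] by simp
  then have "orthogonal_matrix U\<^sub>0"
    using Lim_in_closed_set[OF closed_orthogonal_matrices, of U sequentially U\<^sub>0] sol
    by (simp add: solves_quarter_median_def eventually_conj_iff)
  moreover have "1/2 \<le> measure P (halfspace s \<theta>\<^sub>0 (row i U\<^sub>0))" for s i
  proof -
    have "\<forall>\<^sub>F n in sequentially. 1/2 \<le> measure (Q n) (H s i `` {(\<theta> n, U n)})"
      using sol by eventually_elim (auto simp: solves_quarter_median_def H_section)
    from portmanteau_limit_section[OF lim P Q H_closed conv this]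
    show ?thesis by (simp add: H_section)
  qed
  moreover have "1/4 \<le> measure P (quadrant s s' \<theta>\<^sub>0 (row i U\<^sub>0) (row j U\<^sub>0))" if "i \<noteq> j" for s s' i j
  proof -
    have "\<forall>\<^sub>F n in sequentially. 1/4 \<le> measure (Q n) ((H s i \<inter> H s' j) `` {(\<theta> n, U n)})"
      using sol by eventually_elim (use that in \<open>auto simp: solves_quarter_median_def quadrant_section\<close>)
    from portmanteau_limit_section[OF lim P Q closed_Int[OF H_closed H_closed] conv this]
    show ?thesis by (simp add: quadrant_section)
  qed
  ultimately show ?thesis
    by (simp add: solves_quarter_median_def)
qed

text \<open>
  The mass of the ball exceeds one half, so neither of two opposite half-spaces of mass at least
  one half can miss it. A point of the ball in each of them confines \<open>row i U \<bullet> \<theta>\<close> to \<open>[-r, r]\<close>.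
\<close>

lemma solves_quarter_median_norm_le:
  fixes Q :: "(real^'n) measure"
  assumes "prob_space Q" and sets_Q: "sets Q = sets borel"
    and sol: "solves_quarter_median Q \<theta> U"
    and ball: "measure Q (ball 0 r) > 1/2"
  shows "norm \<theta> \<le> real CARD('n) * r"
proof -
  interpret prob_space Q by fact
  have U: "orthogonal_matrix U"
    using sol by (simp add: solves_quarter_median_def)
  have meets: "\<exists>x. norm x < r \<and> x \<in> halfspace s \<theta> (row i U)" for s i
  proof (rule ccontr)
    assume "\<not> ?thesis"
    then have disj: "ball 0 r \<inter> halfspace s \<theta> (row i U) = {}" by auto
    have "closed (halfspace s \<theta> (row i U))"
      by (cases s) (auto intro!: closed_Collect_le continuous_intros)
    then have "measure Q (ball 0 r \<union> halfspace s \<theta> (row i U)) =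
        measure Q (ball 0 r) + measure Q (halfspace s \<theta> (row i U))"
      using disj sets_Q by (intro finite_measure_Union) auto
    moreover have "measure Q (halfspace s \<theta> (row i U)) \<ge> 1/2"
      using sol by (simp add: solves_quarter_median_def)
    moreover have "measure Q (ball 0 r \<union> halfspace s \<theta> (row i U)) \<le> 1"
      by (rule prob_le_1)
    ultimately show False using ball by linarith
  qed
  have coord: "\<bar>(U *v \<theta>) $ i\<bar> \<le> r" for i
  proof -
    have norm_row: "norm (row i U) = 1"
      using U by (simp add: orthogonal_matrix_orthonormal_rows)
    have inner_less: "\<bar>row i U \<bullet> x\<bar> < r" if "norm x < r" for x
      using Cauchy_Schwarz_ineq2[of "row i U" x] norm_row that by simp
    obtain x y where "norm x < r" "row i U \<bullet> (x - \<theta>) \<le> 0" "norm y < r" "row i U \<bullet> (y - \<theta>) \<ge> 0"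
      using meets[of Minus i] meets[of Plus i] by auto
    then have "\<bar>row i U \<bullet> \<theta>\<bar> \<le> r"
      using inner_less[of x] inner_less[of y] by (simp add: inner_diff_right)
    then show ?thesis
      by (simp add: matrix_vector_mul_component row_def)
  qed
  have "norm \<theta> = norm (U *v \<theta>)"
    using U orthogonal_transformation_norm[of "(*v) U" \<theta>]
    by (simp add: orthogonal_transformation_matrix)
  also have "\<dots> \<le> (\<Sum>i\<in>UNIV. \<bar>(U *v \<theta>) $ i\<bar>)"
    by (rule norm_le_l1_cart)
  also have "\<dots> \<le> real CARD('n) * r"
    using coord sum_bounded_above[of UNIV "\<lambda>i. \<bar>(U *v \<theta>) $ i\<bar>" r] by simp
  finally show ?thesis .
qed

lemma bounded_orthogonal_matrices: "bounded {U :: real^'n^'n. orthogonal_matrix U}"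
proof (rule boundedI)
  fix U :: "real^'n^'n" assume "U \<in> {U. orthogonal_matrix U}"
  then have "norm (U $ i) = 1" for i
    by (simp add: orthogonal_matrix_orthonormal_rows row_def)
  then show "norm U \<le> real CARD('n)"
    unfolding norm_vec_def[of U] using L2_set_le_sum[of UNIV "\<lambda>i. norm (U $ i)"] by simp
qed

text \<open>
  The solutions for \<open>Q n\<close> eventually lie in one compact set, since the mass of a large ball exceeds
  one half. If infinitely many of them avoided \<open>W\<close>, these would have a limit point outside \<open>W\<close>; but
  limit points are solutions for \<open>P\<close>.
\<close>

theorem eventually_near_solutions:
  fixes P :: "(real^'n) measure"
  assumes lim: "portmanteau_limit Q P"
    and P: "prob_space P" "sets P = sets borel"
    and Q: "\<forall>\<^sub>F n in sequentially. prob_space (Q n)" "\<And>n. sets (Q n) = sets borel"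
    and sol: "\<forall>\<^sub>F n in sequentially. solves_quarter_median (Q n) (\<theta> n) (U n)"
    and W: "open W"
    and solutions: "\<And>\<theta>' U'. solves_quarter_median P \<theta>' U' \<Longrightarrow> (\<theta>', U') \<in> W"
  shows "\<forall>\<^sub>F n in sequentially. (\<theta> n, U n) \<in> W"
proof -
  interpret P: prob_space P by fact
  have UN_ball: "(\<Union>k. ball (0 :: real^'n) (real k)) = UNIV"
    using reals_Archimedean2 by auto
  have "(\<lambda>k. measure P (ball 0 (real k))) \<longlonglongrightarrow> measure P (\<Union>k. ball 0 (real k))"
    by (rule P.finite_Lim_measure_incseq) (auto simp: P(2) incseq_def)
  then have "(\<lambda>k. measure P (ball 0 (real k))) \<longlonglongrightarrow> 1"
    using UN_ball P.prob_space sets_eq_imp_space_eq[OF P(2)] by simp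
  then have "\<forall>\<^sub>F k in sequentially. 1/2 < measure P (ball 0 (real k))"
    by (rule order_tendstoD) simp
  then obtain k where "1/2 < measure P (ball 0 (real k))"
    using eventually_happens by force
  then have ball: "\<forall>\<^sub>F n in sequentially. 1/2 < measure (Q n) (ball 0 (real k))"
    by (rule portmanteau_limitD[OF lim open_ball])
  define K where "K = cball (0 :: real^'n) (real CARD('n) * real k) \<times> {U :: real^'n^'n. orthogonal_matrix U}"
  have "compact K"
    unfolding K_def
    by (intro compact_Times compact_cball)
       (simp add: compact_eq_bounded_closed closed_orthogonal_matrices bounded_orthogonal_matrices)
  moreover have "\<forall>\<^sub>F n in sequentially. (\<theta> n, U n) \<in> K"
    using ball sol Q(1)
  proof eventually_elim
    case (elim n)
    then show ?case
      using solves_quarter_median_norm_le[OF elim(3) Q(2) elim(2,1)]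
      by (simp add: K_def solves_quarter_median_def)
  qed
  ultimately show ?thesis
  proof (rule eventually_in_open_of_limit_points[OF _ _ W])
    fix r l assume r: "strict_mono (r :: nat \<Rightarrow> nat)" and l: "(\<lambda>n. (\<theta> (r n), U (r n))) \<longlonglongrightarrow> l"
    have "solves_quarter_median P (fst l) (snd l)"
      using solves_quarter_median_limit[OF portmanteau_limit_subseq[OF lim r] P
          eventually_subseq[OF r Q(1)] Q(2) eventually_subseq[OF r sol], of "fst l" "snd l"] l
      by simp
    then show "l \<in> W"
      using solutions by force
  qed
qed

section \<open>The topology on orthogonal frames up to signed permutations\<close>

text \<open>
  Multiplying one row by the determinant changes at most the sign of that row, and it
  makes the determinant one.
\<close>

definition to_rotation :: "real^'n^'n \<Rightarrow> real^'n^'n" where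
  "to_rotation U = (\<chi> i. if i = (SOME i. True) then det U *s U $ i else U $ i)"

lemma row_to_rotation:
  "row i (to_rotation U) = (if i = (SOME i. True) then det U *\<^sub>R row i U else row i U)"
  by (simp add: to_rotation_def row_def scalar_mult_eq_scaleR vec_eq_iff)

lemma rotation_to_rotation:
  assumes "orthogonal_matrix U"
  shows "rotation_matrix (to_rotation U)"
proof -
  have det: "\<bar>det U\<bar> = 1"
    using det_orthogonal_matrix[OF assms] by auto
  have "orthogonal_matrix (to_rotation U)"
    using assms det
    unfolding orthogonal_matrix_orthonormal_rows row_to_rotation by (auto simp: orthogonal_def)
  moreover have "det (to_rotation U) = det U * det U"
    unfolding to_rotation_def
    by (subst det_row_mul[of "SOME i. True" "det U" "\<lambda>i. U $ i" "\<lambda>i. U $ i"]) simp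
  ultimately show ?thesis
    using det_orthogonal_matrix[OF assms] by (auto simp: rotation_matrix_def)
qed

lemma hyperplane_class_to_rotation:
  assumes "orthogonal_matrix U"
  shows "hyperplane_class (to_rotation U) = hyperplane_class U"
proof -
  have "det U \<noteq> 0"
    using det_orthogonal_matrix[OF assms] by auto
  then have "hyperplanes (to_rotation U) = hyperplanes U"
    unfolding hyperplanes_def row_to_rotation by (intro image_cong) auto
  then have "(to_rotation U, U) \<in> hyperplane_equiv"
    using assms rotation_to_rotation[OF assms]
    by (simp add: hyperplane_equiv_def rotation_matrix_def)
  then show ?thesis
    unfolding hyperplane_class_def by (rule equiv_class_eq[OF equiv_hyperplane_equiv])
qed

lemma continuous_on_to_rotation:
  fixes S :: "(real^'n^'n) set"
  shows "continuous_on S to_rotation"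
proof -
  have "continuous_on S (\<lambda>U :: real^'n^'n. det U)"
    unfolding det_def by (intro continuous_intros)
  then have "continuous_on S (\<lambda>U :: real^'n^'n. if i = (SOME i. True) then det U *s U $ i else U $ i)"
    for i
    unfolding scalar_mult_eq_scaleR by (cases "i = (SOME i. True)") (auto intro!: continuous_intros)
  then show ?thesis
    unfolding to_rotation_def[abs_def] by (rule continuous_on_vec_lambda)
qed

text \<open>
  The topology on \<open>hyperplane_space\<close> is defined through rotations only. The retraction onto the
  rotations, which preserves classes, extends continuity to all orthogonal matrices.
\<close>

lemma openin_orthogonal_hyperplane_class:
  fixes W :: "(real^'n^'n) set set"
  assumes "openin hyperplane_topology W"
  shows "openin (top_of_set {U. orthogonal_matrix U}) {U. orthogonal_matrix U \<and> hyperplane_class U \<in> W}"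
proof -
  have "openin (top_of_set {U. rotation_matrix U}) {U. rotation_matrix U \<and> hyperplane_class U \<in> W}"
    using assms by (simp add: openin_hyperplane_topology)
  then have "openin (top_of_set {U. orthogonal_matrix U})
      ({U. orthogonal_matrix U} \<inter> to_rotation -` {U. rotation_matrix U \<and> hyperplane_class U \<in> W})"
    by (intro continuous_openin_preimage[OF continuous_on_to_rotation])
       (auto intro: rotation_to_rotation)
  also have "{U. orthogonal_matrix U} \<inter> to_rotation -` {U. rotation_matrix U \<and> hyperplane_class U \<in> W} =
      {U. orthogonal_matrix U \<and> hyperplane_class U \<in> W}"
    by (auto simp: hyperplane_class_to_rotation rotation_to_rotation)
  finally show ?thesis .
qed

section \<open>Consistency of empirical quarter medians\<close>

theorem theorem2:
  fixes P :: "(real^'n) measure"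
    and M :: "'w measure"
    and X :: "nat \<Rightarrow> 'w \<Rightarrow> real^'n"
    and \<theta>\<^sub>n :: "nat \<Rightarrow> (nat \<Rightarrow> real^'n) \<Rightarrow> real^'n"
    and U\<^sub>n :: "nat \<Rightarrow> (nat \<Rightarrow> real^'n) \<Rightarrow> real^'n^'n"
  assumes "CARD('n) \<ge> 2"
    and "prob_space P" and "sets P = sets borel"
    and "\<And>a. a \<in> sphere 0 1 \<Longrightarrow> \<exists>!m. is_median (projection_law P a) m"
    and "prob_space M"
    and "prob_space.indep_vars M (\<lambda>_. borel) X {1..}"
    and "\<And>k. k \<ge> 1 \<Longrightarrow> distr M borel (X k) = P"
    and "\<And>n. n \<ge> 1 \<Longrightarrow> \<theta>\<^sub>n n \<in> borel_measurable (Pi\<^sub>M {1..n} (\<lambda>_. borel))"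
    and "\<And>n. n \<ge> 1 \<Longrightarrow> U\<^sub>n n \<in> borel_measurable (Pi\<^sub>M {1..n} (\<lambda>_. borel))"
    and "\<And>n. n \<ge> 1 \<Longrightarrow> AE \<omega> in M.
           solves_quarter_median (empirical_measure n (\<lambda>k. X k \<omega>))
             (\<theta>\<^sub>n n (\<lambda>k\<in>{1..n}. X k \<omega>)) (U\<^sub>n n (\<lambda>k\<in>{1..n}. X k \<omega>))"
  shows "(\<forall>\<theta>. quarter_median_unique P \<and> is_quarter_median P \<theta> \<longrightarrow>
            (AE \<omega> in M. (\<lambda>n. \<theta>\<^sub>n n (\<lambda>k\<in>{1..n}. X k \<omega>)) \<longlonglongrightarrow> \<theta>)) \<and>
         (\<forall>\<theta>. \<forall>H\<in>hyperplane_space.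
            (\<forall>\<theta>\<^sub>1 U\<^sub>1. solves_quarter_median P \<theta>\<^sub>1 U\<^sub>1 \<longrightarrow> \<theta>\<^sub>1 = \<theta> \<and> hyperplane_class U\<^sub>1 = H) \<longrightarrow>
            (AE \<omega> in M. limitin (prod_topology euclidean hyperplane_topology)
               (\<lambda>n. (\<theta>\<^sub>n n (\<lambda>k\<in>{1..n}. X k \<omega>), hyperplane_class (U\<^sub>n n (\<lambda>k\<in>{1..n}. X k \<omega>))))
               (\<theta>, H) sequentially))"
proof (intro conjI allI ballI impI)
  interpret prob_space M by fact
  let ?Q = "\<lambda>\<omega> n. empirical_measure n (\<lambda>k. X k \<omega>)"
  let ?T = "\<lambda>\<omega> n. \<theta>\<^sub>n n (\<lambda>k\<in>{1..n}. X k \<omega>)"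
  let ?U = "\<lambda>\<omega> n. U\<^sub>n n (\<lambda>k\<in>{1..n}. X k \<omega>)"
  have "AE \<omega> in M. \<forall>n\<in>{1..}. solves_quarter_median (?Q \<omega> n) (?T \<omega> n) (?U \<omega> n)"
    using assms(10) by (subst AE_ball_countable) auto
  moreover have "AE \<omega> in M. portmanteau_limit (?Q \<omega>) P"
    by (rule AE_empirical_portmanteau[OF assms(6,7)])
  \<comment> \<open>A limit is a statement about all neighbourhoods \<open>W\<close>, so one null set must serve them all.\<close>
  ultimately have near: "AE \<omega> in M. \<forall>W. open W \<longrightarrow>
      (\<forall>\<theta>' U'. solves_quarter_median P \<theta>' U' \<longrightarrow> (\<theta>', U') \<in> W) \<longrightarrow>
      (\<forall>\<^sub>F n in sequentially. (?T \<omega> n, ?U \<omega> n) \<in> W \<and> orthogonal_matrix (?U \<omega> n))"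
  proof eventually_elim
    case (elim \<omega>)
    have sol: "\<forall>\<^sub>F n in sequentially. solves_quarter_median (?Q \<omega> n) (?T \<omega> n) (?U \<omega> n)"
      using eventually_ge_at_top[of 1] by eventually_elim (use elim(1) in auto)
    have prob: "\<forall>\<^sub>F n in sequentially. prob_space (?Q \<omega> n)"
      using eventually_ge_at_top[of 1] by eventually_elim (rule prob_space_empirical_measure)
    show ?case
    proof (intro allI impI eventually_conj)
      fix W :: "((real^'n) \<times> (real^'n^'n)) set"
      assume "open W" "\<forall>\<theta>' U'. solves_quarter_median P \<theta>' U' \<longrightarrow> (\<theta>', U') \<in> W"
      then show "\<forall>\<^sub>F n in sequentially. (?T \<omega> n, ?U \<omega> n) \<in> W"
        by (intro eventually_near_solutions[OF elim(2) assms(2,3) prob _ sol]) auto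
      show "\<forall>\<^sub>F n in sequentially. orthogonal_matrix (?U \<omega> n)"
        using sol by eventually_elim (simp add: solves_quarter_median_def)
    qed
  qed
  show "AE \<omega> in M. (\<lambda>n. ?T \<omega> n) \<longlonglongrightarrow> \<theta>"
    if uniq: "quarter_median_unique P \<and> is_quarter_median P \<theta>" for \<theta>
    using near
  proof eventually_elim
    case (elim \<omega>)
    show ?case
    proof (rule topological_tendstoI)
      fix S assume S: "open S" "\<theta> \<in> S"
      have "\<theta>' = \<theta>" if "solves_quarter_median P \<theta>' U'" for \<theta>' U'
        using uniq that unfolding quarter_median_unique_def is_quarter_median_def by blast
      then have "\<forall>\<^sub>F n in sequentially. (?T \<omega> n, ?U \<omega> n) \<in> S \<times> UNIV \<and> orthogonal_matrix (?U \<omega> n)"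
        using S by (intro elim[rule_format] open_Times) auto
      then show "\<forall>\<^sub>F n in sequentially. ?T \<omega> n \<in> S"
        by eventually_elim simp
    qed
  qed
  show "AE \<omega> in M. limitin (prod_topology euclidean hyperplane_topology)
      (\<lambda>n. (?T \<omega> n, hyperplane_class (?U \<omega> n))) (\<theta>, H) sequentially"
    if H: "H \<in> hyperplane_space"
      and uniq: "\<forall>\<theta>\<^sub>1 U\<^sub>1. solves_quarter_median P \<theta>\<^sub>1 U\<^sub>1 \<longrightarrow> \<theta>\<^sub>1 = \<theta> \<and> hyperplane_class U\<^sub>1 = H"
    for \<theta> H
    using near
  proof eventually_elim
    case (elim \<omega>)
    have near_SV: "\<forall>\<^sub>F n in sequentially. ?T \<omega> n \<in> S \<and> hyperplane_class (?U \<omega> n) \<in> V"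
      if S: "open S" "\<theta> \<in> S" and V: "openin hyperplane_topology V" "H \<in> V" for S V
    proof -
      obtain W where W: "open W"
        "{U. orthogonal_matrix U \<and> hyperplane_class U \<in> V} = {U. orthogonal_matrix U} \<inter> W"
        using openin_orthogonal_hyperplane_class[OF V(1)] unfolding openin_open by blast
      have "(\<theta>', U') \<in> S \<times> W" if "solves_quarter_median P \<theta>' U'" for \<theta>' U'
        using that uniq W(2) S(2) V(2) by (auto simp: solves_quarter_median_def)
      then have "\<forall>\<^sub>F n in sequentially. (?T \<omega> n, ?U \<omega> n) \<in> S \<times> W \<and> orthogonal_matrix (?U \<omega> n)"
        using S(1) W(1) by (intro elim[rule_format] open_Times) auto
      then show ?thesis
        by eventually_elim (use W(2) in auto)
    qed
    show ?case
      unfolding limitin_def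
    proof (intro conjI allI impI)
      show "(\<theta>, H) \<in> topspace (prod_topology euclidean hyperplane_topology)"
        using H by (simp add: topspace_hyperplane_topology)
      fix T assume "openin (prod_topology euclidean hyperplane_topology) T \<and> (\<theta>, H) \<in> T"
      then obtain S V where SV: "open S" "openin hyperplane_topology V" "\<theta> \<in> S" "H \<in> V" "S \<times> V \<subseteq> T"
        unfolding openin_prod_topology_alt by (metis open_openin)
      show "\<forall>\<^sub>F n in sequentially. (?T \<omega> n, hyperplane_class (?U \<omega> n)) \<in> T"
        using near_SV[OF SV(1,3,2,4)] by eventually_elim (use SV(5) in auto)
    qed
  qed
qed

end
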